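(* Let $m\ge1$. If $m$ is odd, then every compact magic hypercube of order $4$ and dimension $m$ is automatically pandiagonal. If $m$ is even, then every compact and pandiagonal magic hypercube of order $4$ and dimension $m$ is automatically most-perfect.
   Context: A magic hypercube of order $4$ and dimension $m$ is an arrangement of the numbers $1,2,\ldots,4^m$ (each used once) in a $4\times\cdots\times4$ ($m$-fold) grid, with positions indexed by $(\mathbb Z/4\mathbb Z)^m$, such that every orthogonal line (four positions obtained by fixing all but one coordinate) has the same magic sum. It is compact if every $2\times2$ subsquare (positions obtained by fixing all but two coordinates and letting those two range over $\{i,i+1\}\times\{k,k+1\}$ modulo $4$, wrap-around included) also has that magic sum. A great pandiagonal is a toroidal line $\{p+t\,d: t\in\mathbb Z/4\mathbb Z\}$ with $p\in(\mathbb Z/4\mathbb Z)^m$, $d\in\{\pm1\}^m$ (this includes great diagonals). The hypercube is pandiagonal if every great pandiagonal has the magic sum; it is complete if every pair of entries two apart on a great pandiagonal adds up to half the magic sum; it is most-perfect if it is magic, compact, pandiagonal and complete. *)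

theory Defs
  imports "HOL-Analysis.Finite_Cartesian_Product"
begin

text \<open>
  The numeral type \<open>4\<close> is the ring of integers modulo 4, so \<open>4 ^ 'n\<close> with \<open>m = CARD('n)\<close> is the
  position group, and wrap-around is built into its arithmetic.  The condition \<open>m \<ge> 1\<close> is
  automatic because HOL types are nonempty.
\<close>

type_synonym 'n hypercube = "4 ^ 'n \<Rightarrow> nat"

definition orthogonal_line :: "'n::finite \<Rightarrow> 4 ^ 'n \<Rightarrow> (4 ^ 'n) set" where
  "orthogonal_line i p = {q. \<forall>j. j \<noteq> i \<longrightarrow> q $ j = p $ j}"

definition subsquare :: "'n::finite \<Rightarrow> 'n \<Rightarrow> 4 ^ 'n \<Rightarrow> (4 ^ 'n) set" where
  "subsquare i j p =
    {q. q $ i \<in> {p $ i, p $ i + 1} \<and> q $ j \<in> {p $ j, p $ j + 1} \<and>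
        (\<forall>k. k \<noteq> i \<and> k \<noteq> j \<longrightarrow> q $ k = p $ k)}"

definition diagonal_directions :: "(4 ^ 'n::finite) set" where
  "diagonal_directions = {d. \<forall>i. d $ i \<in> {1, -1}}"

definition great_pandiagonal :: "4 ^ 'n::finite \<Rightarrow> 4 ^ 'n \<Rightarrow> (4 ^ 'n) set" where
  "great_pandiagonal p d = {p + t *s d | t :: 4. True}"

definition magic_hypercube :: "'n::finite hypercube \<Rightarrow> bool" where
  "magic_hypercube H \<longleftrightarrow>
    bij_betw H UNIV {1..4 ^ CARD('n)} \<and> (\<exists>S. \<forall>i p. sum H (orthogonal_line i p) = S)"

text \<open>Only meaningful for magic hypercubes, where the common line sum exists.\<close>

definition magic_sum :: "'n::finite hypercube \<Rightarrow> nat" where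
  "magic_sum H = (THE S. \<forall>i p. sum H (orthogonal_line i p) = S)"

lemma sum_orthogonal_line:
  assumes "magic_hypercube H"
  shows "sum H (orthogonal_line i p) = magic_sum H"
proof -
  from assms obtain S where S: "\<forall>i p. sum H (orthogonal_line i p) = S"
    by (auto simp: magic_hypercube_def)
  then have "magic_sum H = S"
    unfolding magic_sum_def by (intro the_equality) auto
  with S show ?thesis by simp
qed

definition compact_hypercube :: "'n::finite hypercube \<Rightarrow> bool" where
  "compact_hypercube H \<longleftrightarrow>
    (\<forall>i j p. i \<noteq> j \<longrightarrow> sum H (subsquare i j p) = magic_sum H)"

definition pandiagonal_hypercube :: "'n::finite hypercube \<Rightarrow> bool" where
  "pandiagonal_hypercube H \<longleftrightarrow>
    (\<forall>p. \<forall>d\<in>diagonal_directions. sum H (great_pandiagonal p d) = magic_sum H)"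

text \<open>Doubling the pair sum avoids truncating division in ``half the magic sum''.\<close>

definition complete_hypercube :: "'n::finite hypercube \<Rightarrow> bool" where
  "complete_hypercube H \<longleftrightarrow>
    (\<forall>p. \<forall>d\<in>diagonal_directions. 2 * (H p + H (p + 2 *s d)) = magic_sum H)"

definition most_perfect_hypercube :: "'n::finite hypercube \<Rightarrow> bool" where
  "most_perfect_hypercube H \<longleftrightarrow>
    magic_hypercube H \<and> compact_hypercube H \<and> pandiagonal_hypercube H \<and> complete_hypercube H"

end

theory Submission
  imports Defs "HOL-Analysis.Cartesian_Space"
begin

text \<open>
  Let \<open>F p = (-1)\<^bsup>p\<^sub>1 + \<dots> + p\<^sub>m\<^esup> (4 H p - S)\<close>, where \<open>S\<close> is the magic sum. Compactness says that all
  mixed second differences of \<open>F\<close> vanish, so \<open>F p = c + (\<Sum>i. g i (p $ i))\<close>, and the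
  line sums give \<open>g i 0 + g i 2 = g i 1 + g i 3\<close> for every \<open>i\<close>. Along a great pandiagonal the sign is
  \<open>(-1)\<^bsup>t m\<^esup>\<close>. For odd \<open>m\<close> it alternates and everything cancels. For even \<open>m\<close> it is constant, so both
  the pandiagonal sums and (twice) the sums of entries two apart are, up to sign, the same
  number \<open>4 c + (\<Sum>i. \<Sum>x. g i x)\<close>, which vanishes if the hypercube is pandiagonal.
\<close>

section \<open>Arithmetic modulo 4 and unit vectors\<close>

lemma four_eq_zero_mod4: "(4::4) = 0"
  by simp

lemma mod4_induct: "P 0 \<Longrightarrow> (\<And>x. P x \<Longrightarrow> P (x + 1)) \<Longrightarrow> P (x::4)"
proof -
  assume 0: "P 0" and step: "\<And>x. P x \<Longrightarrow> P (x + 1)"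
  have "P 1" "P 2" "P 3"
    using step[OF 0] step[OF step[OF 0]] step[OF step[OF step[OF 0]]] by simp_all
  \<comment> \<open>\<open>exhaust_4\<close> lists the residues as 1, 2, 3, 4, so the residue 0
    appears there as \<open>4\<close>.\<close>
  moreover have "P 4" using 0 by (simp only: four_eq_zero_mod4)
  ultimately show ?thesis using exhaust_4[of x] by auto
qed

lemma sum_mod4: "sum f (UNIV :: 4 set) = f 0 + f 1 + f 2 + f 3"
  unfolding sum_4 four_eq_zero_mod4 by (simp only: ac_simps)

lemma axis_add: "axis i (x + y) = axis i x + axis i (y :: 'a::monoid_add)"
  by (simp add: vec_eq_iff axis_def)

lemma axis_zero: "axis i 0 = 0"
  by (simp add: vec_eq_iff axis_def)

lemma sum_axis: "(\<Sum>i\<in>UNIV. axis i (p $ i)) = p"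
  for p :: "'a::comm_monoid_add ^ 'n::finite"
  by (simp add: vec_eq_iff axis_def cong: if_cong)

section \<open>Sums over lines and subsquares\<close>

lemma sum_orthogonal_line_axis:
  "sum H (orthogonal_line i p) = (\<Sum>t\<in>UNIV. H (p + axis i t))"
proof -
  have "q \<in> range (\<lambda>t. p + axis i t)" if "q \<in> orthogonal_line i p" for q
  proof
    show "q = p + axis i (q $ i - p $ i)"
      using that by (auto simp: vec_eq_iff orthogonal_line_def axis_def)
  qed simp
  then have "orthogonal_line i p = range (\<lambda>t. p + axis i t)"
    by (auto simp: orthogonal_line_def axis_def)
  moreover have "inj (\<lambda>t. p + axis i t)"
    by (auto intro!: injI simp: axis_eq_axis)
  ultimately show ?thesis
    by (simp add: sum.reindex)
qed

lemma sum_great_pandiagonal: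
  assumes "d \<in> diagonal_directions"
  shows "sum H (great_pandiagonal p d) = (\<Sum>t\<in>UNIV. H (p + t *s d))"
proof -
  have "great_pandiagonal p d = range (\<lambda>t. p + t *s d)"
    by (auto simp: great_pandiagonal_def)
  moreover have "inj (\<lambda>t. p + t *s d)"
  proof (rule injI)
    fix s t assume eq: "p + s *s d = p + t *s d"
    \<comment> \<open>Any coordinate will do: the entry \<open>d $ i\<close> is a unit modulo 4 and
      can be cancelled.\<close>
    fix i
    have "s * d $ i = t * d $ i"
      using arg_cong[OF eq, of "\<lambda>v. v $ i"] by simp
    moreover have "d $ i = 1 \<or> d $ i = -1"
      using assms by (auto simp: diagonal_directions_def)
    ultimately show "s = t" by auto
  qed
  ultimately show ?thesis
    by (simp add: sum.reindex)
qed

lemma sum_subsquare: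
  assumes "i \<noteq> j"
  shows "sum H (subsquare i j p)
    = H p + H (p + axis i 1) + H (p + axis j 1) + H (p + axis i 1 + axis j 1)"
proof -
  have "subsquare i j p = {p, p + axis i 1, p + axis j 1, p + axis i 1 + axis j 1}" (is "?L = ?R")
  proof
    show "?R \<subseteq> ?L" using assms by (auto simp: subsquare_def axis_def)
    show "?L \<subseteq> ?R"
    proof
      fix q assume q: "q \<in> ?L"
      have "q = p + axis i (q $ i - p $ i) + axis j (q $ j - p $ j)"
        using q assms by (auto simp: subsquare_def vec_eq_iff axis_def)
      moreover have "q $ i - p $ i \<in> {0, 1}" "q $ j - p $ j \<in> {0, 1}"
        using q by (auto simp: subsquare_def)
      ultimately show "q \<in> ?R" by (auto simp: axis_zero)
    qed
  qed
  \<comment> \<open>The four corners must be pairwise distinct for the sum over the set to have four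
    terms.\<close>
  moreover have "axis i 1 \<noteq> (axis j 1 :: 4 ^ 'a)"
    using assms by (simp add: axis_eq_axis)
  moreover have "axis i 1 + axis j 1 \<noteq> (0 :: 4 ^ 'a)"
  proof
    assume "axis i 1 + axis j 1 = (0 :: 4 ^ 'a)"
    then have "(axis i 1 + axis j 1) $ i = (0 :: 4)" by simp
    then show False using assms by (simp add: axis_def)
  qed
  ultimately show ?thesis
    by (simp add: add.assoc)
qed

section \<open>Separation of variables\<close>

text \<open>The increment of \<open>F\<close> under a unit step along one axis is unchanged by a
  unit step along another. Inductions allow arbitrary steps along the second axis
  (\<open>unit\<close>), then along the first (\<open>diff\<close>), then shifts in any set of other
  coordinates (\<open>add\<close>). Building up \<open>p\<close> one coordinate at a time then adds
  up the increments taken at the origin.\<close>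

lemma separable_if_mixed_differences_zero:
  fixes F :: "4 ^ 'n::finite \<Rightarrow> 'b::ab_group_add"
  assumes mixed: "\<And>i j p. i \<noteq> j \<Longrightarrow>
    F (p + axis i 1 + axis j 1) - F (p + axis j 1) = F (p + axis i 1) - F p"
  shows "F p = F 0 + (\<Sum>i\<in>UNIV. F (axis i (p $ i)) - F 0)"
proof -
  have unit: "F (p + axis i 1 + axis j x) - F (p + axis j x) = F (p + axis i 1) - F p"
    if "i \<noteq> j" for i j x p
  proof (induction x rule: mod4_induct)
    case 1
    show ?case by (simp add: axis_zero)
  next
    case (2 x)
    then show ?case
      using mixed[OF that, of "p + axis j x"] by (simp add: axis_add ac_simps)
  qed
  have diff: "F (p + axis i y + axis j x) - F (p + axis j x) = F (p + axis i y) - F p"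
    if "i \<noteq> j" for i j x y p
  proof (induction y rule: mod4_induct)
    case 1
    show ?case by (simp add: axis_zero)
  next
    case (2 y)
    have "F (p + axis i (y + 1) + axis j x) - F (p + axis j x)
      = (F ((p + axis i y) + axis i 1 + axis j x) - F ((p + axis i y) + axis j x))
        + (F (p + axis i y + axis j x) - F (p + axis j x))"
      by (simp add: axis_add ac_simps)
    also have "\<dots> = (F ((p + axis i y) + axis i 1) - F (p + axis i y)) + (F (p + axis i y) - F p)"
      by (simp only: unit[OF that] 2)
    finally show ?case by (simp add: axis_add ac_simps)
  qed
  have add: "F (axis i y + (\<Sum>j\<in>A. axis j (p $ j))) - F (\<Sum>j\<in>A. axis j (p $ j)) = F (axis i y) - F 0"
    if "i \<notin> A" for i y A
    using finite[of A] that
  proof (induction A rule: finite_induct)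
    case empty
    show ?case by simp
  next
    case (insert j A)
    then show ?case
      using diff[of i j "\<Sum>j\<in>A. axis j (p $ j)" y "p $ j"] by (simp add: ac_simps)
  qed
  have "F (\<Sum>i\<in>A. axis i (p $ i)) = F 0 + (\<Sum>i\<in>A. F (axis i (p $ i)) - F 0)" for A
    using finite[of A]
  proof (induction A rule: finite_induct)
    case empty
    show ?case by simp
  next
    case (insert j A)
    then show ?case
      using add[of j A "p $ j"] by (simp add: algebra_simps)
  qed
  moreover have "(\<Sum>i\<in>UNIV. axis i (p $ i)) = p"
    by (rule sum_axis)
  ultimately show ?thesis by metis
qed

section \<open>The checkerboard sign\<close>

text \<open>This is (-1)^x, well defined on residues modulo 4 because 4 is even.\<close>

definition alt_sign :: "4 \<Rightarrow> int" where
  "alt_sign x = (if x \<in> {0, 2} then 1 else -1)"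

lemma alt_sign_add: "alt_sign (x + y) = alt_sign x * alt_sign y"
  using exhaust_4[of x] exhaust_4[of y] by (auto simp: alt_sign_def)

lemma alt_sign_uminus: "alt_sign (- x) = alt_sign x"
  using exhaust_4[of x] by (auto simp: alt_sign_def)

lemma alt_sign_simps [simp]: "alt_sign 0 = 1" "alt_sign 1 = -1" "alt_sign 2 = 1" "alt_sign 3 = -1"
  by (auto simp: alt_sign_def)

definition checker :: "4 ^ 'n::finite \<Rightarrow> int" where
  "checker p = (\<Prod>i\<in>UNIV. alt_sign (p $ i))"

lemma checker_add: "checker (p + q) = checker p * checker q"
  by (simp add: checker_def alt_sign_add prod.distrib)

lemma checker_axis: "checker (axis i x) = alt_sign x"
proof -
  have "checker (axis i x) = (\<Prod>j\<in>UNIV. if j = i then alt_sign x else 1)"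
    unfolding checker_def by (intro prod.cong) (auto simp: axis_def)
  then show ?thesis by (simp add: prod.delta')
qed

text \<open>Each of the coordinates of \<open>t *s d\<close> is \<open>t\<close> or
  \<open>- t\<close> and has the sign of \<open>t\<close>. This is where the parity of the dimension
  enters.\<close>

lemma checker_scale_diagonal:
  fixes d :: "4 ^ 'n::finite"
  assumes "d \<in> diagonal_directions"
  shows "checker (t *s d) = alt_sign t ^ CARD('n)"
proof -
  have "alt_sign (t * d $ i) = alt_sign t" for i
  proof -
    have "d $ i = 1 \<or> d $ i = -1"
      using assms by (auto simp: diagonal_directions_def)
    then show ?thesis by (auto simp: alt_sign_uminus)
  qed
  then show ?thesis by (simp add: checker_def)
qed

lemma checker_square: "checker p * checker p = 1"
proof -
  have "alt_sign x * alt_sign x = 1" for x by (simp add: alt_sign_def)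
  then show ?thesis by (simp add: checker_def flip: prod.distrib)
qed

text \<open>For either sign of \<open>e\<close>, the points \<open>x\<close> and
  \<open>x + 2 * e\<close> form one parity class modulo 4, and \<open>x + e\<close> and
  \<open>x + 3 * e\<close> the other.\<close>

lemma diagonal_alternating:
  fixes g :: "4 \<Rightarrow> 'b::ab_semigroup_add"
  assumes g: "g 0 + g 2 = g 1 + g 3" and e: "e \<in> {1, -1}"
  shows "g x + g (x + 2 * e) = g (x + e) + g (x + 3 * e)"
proof -
  have neg: "-1 = (3::4)" by simp
  have reduce: "4 = (0::4)" "5 = (1::4)" "6 = (2::4)" "7 = (3::4)" "8 = (0::4)" "9 = (1::4)"
    "10 = (2::4)" "11 = (3::4)" "12 = (0::4)" by simp_all
  show ?thesis
    using g e exhaust_4[of x] unfolding neg by (auto simp: reduce add.commute)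
qed

section \<open>Structure of compact magic hypercubes\<close>

lemma checker_hypercube_separable:
  fixes H :: "'n::finite hypercube"
  assumes magic: "magic_hypercube H" and compact: "compact_hypercube H"
  obtains c :: int and g :: "'n \<Rightarrow> 4 \<Rightarrow> int" where
    "\<And>p. 4 * int (H p) - int (magic_sum H) = checker p * (c + (\<Sum>i\<in>UNIV. g i (p $ i)))"
    "\<And>i. g i 0 + g i 2 = g i 1 + g i 3"
proof -
  \<comment> \<open>Four times the deviation from the mean entry of a line: integral, and with sum 0
    over each line and subsquare.\<close>
  define f where "f p = 4 * int (H p) - int (magic_sum H)" for p
  define F where "F p = checker p * f p" for p
  have f_F: "f p = checker p * F p" for p
    by (simp add: F_def checker_square flip: mult.assoc)
  have line: "f p + f (p + axis i 1) + f (p + axis i 2) + f (p + axis i 3) = 0" for i p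
    using sum_orthogonal_line[OF magic, of i p]
    by (simp add: sum_orthogonal_line_axis sum_mod4 f_def axis_zero)
  have square: "f p + f (p + axis i 1) + f (p + axis j 1) + f (p + axis i 1 + axis j 1) = 0"
    if "i \<noteq> j" for i j p
  proof -
    have "H p + H (p + axis i 1) + H (p + axis j 1) + H (p + axis i 1 + axis j 1) = magic_sum H"
      using compact that by (simp add: compact_hypercube_def flip: sum_subsquare)
    then show ?thesis by (simp add: f_def)
  qed
  have mixed: "F (p + axis i 1 + axis j 1) - F (p + axis j 1) = F (p + axis i 1) - F p"
    if "i \<noteq> j" for i j p
  proof -
    \<comment> \<open>Each unit step flips \<open>checker\<close>, so the equal weights of the
      subsquare become the signs of a mixed second difference.\<close>
    have "F (p + axis i 1 + axis j 1) - F (p + axis j 1) - (F (p + axis i 1) - F p)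
      = checker p * (f p + f (p + axis i 1) + f (p + axis j 1) + f (p + axis i 1 + axis j 1))"
      by (simp add: F_def checker_add checker_axis algebra_simps)
    then show ?thesis using square[OF that] by simp
  qed
  define g where "g i x = F (axis i x) - F 0" for i x
  show thesis
  proof (rule that[of "F 0" g])
    fix p
    have "F p = F 0 + (\<Sum>i\<in>UNIV. g i (p $ i))"
      unfolding g_def by (rule separable_if_mixed_differences_zero) (rule mixed)
    then show "4 * int (H p) - int (magic_sum H) = checker p * (F 0 + (\<Sum>i\<in>UNIV. g i (p $ i)))"
      using f_F[of p] by (simp add: f_def)
  next
    fix i
    \<comment> \<open>On the axis through the origin \<open>checker\<close> alternates, so the
      vanishing line sum of \<open>f\<close> is an alternating sum of \<open>F\<close>, in which the
      constant \<open>F 0\<close> cancels.\<close>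
    have "checker (0 :: 4 ^ 'n) = 1" by (simp add: checker_def)
    then show "g i 0 + g i 2 = g i 1 + g i 3"
      using line[of 0 i] by (simp add: g_def F_def checker_axis axis_zero)
  qed
qed

section \<open>Odd and even dimensions\<close>

theorem theorem12:
  shows "(odd CARD('n::finite) \<longrightarrow>
            (\<forall>H :: 'n hypercube. magic_hypercube H \<and> compact_hypercube H
              \<longrightarrow> pandiagonal_hypercube H)) \<and>
         (even CARD('n) \<longrightarrow>
            (\<forall>H :: 'n hypercube. magic_hypercube H \<and> compact_hypercube H \<and> pandiagonal_hypercube H
              \<longrightarrow> most_perfect_hypercube H))"
proof (intro conjI impI allI; elim conjE)
  fix H :: "'n hypercube"
  assume odd: "odd CARD('n)" and H: "magic_hypercube H" "compact_hypercube H"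
  obtain c :: int and g :: "'n \<Rightarrow> 4 \<Rightarrow> int" where
    dev: "\<And>p. 4 * int (H p) - int (magic_sum H) = checker p * (c + (\<Sum>i\<in>UNIV. g i (p $ i)))"
    and g: "\<And>i. g i 0 + g i 2 = g i 1 + g i 3"
    by (rule checker_hypercube_separable[OF H]) (rule that)
  show "pandiagonal_hypercube H"
    unfolding pandiagonal_hypercube_def
  proof (intro allI ballI)
    fix p d :: "4 ^ 'n" assume d: "d \<in> diagonal_directions"
    have alt: "g i (p $ i) + g i (p $ i + 2 * d $ i)
      = g i (p $ i + d $ i) + g i (p $ i + 3 * d $ i)" for i
      using diagonal_alternating[of "g i", OF g, of "d $ i" "p $ i"] d
      by (simp add: diagonal_directions_def)
    have "4 * int (sum H (great_pandiagonal p d)) - 4 * int (magic_sum H)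
      = (\<Sum>t\<in>UNIV. 4 * int (H (p + t *s d)) - int (magic_sum H))"
      by (simp add: sum_great_pandiagonal[OF d] sum_mod4)
    \<comment> \<open>An odd power of \<open>alt_sign t\<close> is \<open>alt_sign t\<close>
      itself.\<close>
    also have "\<dots> = checker p * (\<Sum>t\<in>UNIV. alt_sign t * (c + (\<Sum>i\<in>UNIV. g i (p $ i + t * d $ i))))"
      using odd
      by (simp add: dev checker_add checker_scale_diagonal[OF d] sum_mod4 algebra_simps)
    \<comment> \<open>The constant \<open>c\<close> drops out, being taken twice with each
      sign.\<close>
    also have "(\<Sum>t\<in>UNIV. alt_sign t * (c + (\<Sum>i\<in>UNIV. g i (p $ i + t * d $ i))))
      = (\<Sum>i\<in>UNIV. g i (p $ i) + g i (p $ i + 2 * d $ i)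
          - (g i (p $ i + d $ i) + g i (p $ i + 3 * d $ i)))"
      by (simp add: sum_mod4 sum.distrib sum_subtractf)
    also have "\<dots> = 0" by (simp add: alt)
    finally show "sum H (great_pandiagonal p d) = magic_sum H" by (simp del: of_nat_sum)
  qed
next
  fix H :: "'n hypercube"
  assume even: "even CARD('n)" and H: "magic_hypercube H" "compact_hypercube H"
    and pan: "pandiagonal_hypercube H"
  obtain c :: int and g :: "'n \<Rightarrow> 4 \<Rightarrow> int" where
    dev: "\<And>p. 4 * int (H p) - int (magic_sum H) = checker p * (c + (\<Sum>i\<in>UNIV. g i (p $ i)))"
    and g: "\<And>i. g i 0 + g i 2 = g i 1 + g i 3"
    by (rule checker_hypercube_separable[OF H]) (rule that)
  have "2 * (H p + H (p + 2 *s d)) = magic_sum H" if d: "d \<in> diagonal_directions" for p d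
  proof -
    let ?G = "\<lambda>t. c + (\<Sum>i\<in>UNIV. g i (p $ i + t * d $ i))"
    \<comment> \<open>Steps 0 and 2 contribute as much as steps 1 and 3, hence half of the
      total.\<close>
    have pair: "2 * (g i (p $ i) + g i (p $ i + 2 * d $ i)) =
      g i (p $ i) + g i (p $ i + d $ i) + g i (p $ i + 2 * d $ i) + g i (p $ i + 3 * d $ i)" for i
      using diagonal_alternating[of "g i", OF g, of "d $ i" "p $ i"] d
      by (simp add: diagonal_directions_def)
    \<comment> \<open>An even power of \<open>alt_sign t\<close> is 1, so the sign is constant along
      the pandiagonal.\<close>
    have dev_d: "4 * int (H (p + t *s d)) - int (magic_sum H) = checker p * ?G t" for t
      using even by (simp add: dev checker_add checker_scale_diagonal[OF d] alt_sign_def)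
    have "2 * (?G 0 + ?G 2) = 4 * c + (\<Sum>i\<in>UNIV. 2 * (g i (p $ i) + g i (p $ i + 2 * d $ i)))"
      by (simp add: sum.distrib flip: sum_distrib_left)
    also have "\<dots> = ?G 0 + ?G 1 + ?G 2 + ?G 3"
      unfolding pair by (simp add: sum.distrib)
    also have "\<dots> = (\<Sum>t\<in>UNIV. ?G t)"
      by (simp only: sum_mod4)
    finally have "checker p * (2 * (?G 0 + ?G 2)) = (\<Sum>t\<in>UNIV. checker p * ?G t)"
      by (simp only: sum_distrib_left)
    also have "\<dots> = 4 * int (sum H (great_pandiagonal p d)) - 4 * int (magic_sum H)"
      by (simp flip: dev_d add: sum_great_pandiagonal[OF d] sum_mod4)
    also have "\<dots> = 0"
      using pan d by (simp add: pandiagonal_hypercube_def)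
    \<comment> \<open>The sum of the two deviations, doubled, is the deviation of the whole
      pandiagonal, which is 0 by \<open>pan\<close>.\<close>
    finally have "checker p * ?G 0 + checker p * ?G 2 = 0"
      by (simp add: algebra_simps)
    then have "4 * int (H (p + 0 *s d)) + 4 * int (H (p + 2 *s d)) = 2 * int (magic_sum H)"
      using dev_d[of 0] dev_d[of 2] by linarith
    then show ?thesis by simp
  qed
  then show "most_perfect_hypercube H"
    using H pan by (simp add: most_perfect_hypercube_def complete_hypercube_def)
qed

end
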